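(* Let $\tau$ be a random time with geometric distribution $P(\tau=t)=(1-\beta)\beta^t$, $t=0,1,2,\dots$, independent of $\{\mathcal F_t:\ t=0,1,\dots\}$ (and of the scenario $\omega$). For $H\in\mathcal D$ set $$I_H(\mathbf a,\omega,\tau)=\sum_{t=0}^{\tau}\Big(R(\mathbf x_t,\mathbf a_t)+\beta\,\mathbb E[H(\mathbf x_{t+1})\mid \mathbf x_t,\mathbf a_t]-H(\mathbf x_t)\Big),\qquad \mathcal LH(\mathbf x_0)=H(\mathbf x_0)+\mathbb E\Big[\max_{\mathbf a\in\bar{\mathcal A}(\tau)} I_H(\mathbf a,\omega,\tau)\,\Big|\,\mathbf x_0\Big].$$ Then: (a) (Weak duality) For any $H\in\mathcal D$, $V(\mathbf x)\le \mathcal LH(\mathbf x)$ for all $\mathbf x\in\mathcal X$. (b) (Tighter bound) Let $$\mathcal D^*=\{H\in\mathcal D:\ R(\mathbf x_0,\mathbf a_0)+\beta\,\mathbb E[H(\mathbf x_1)\mid\mathbf x_0,\mathbf a_0]\le H(\mathbf x_0)\ \text{ for all } \mathbf x_0\in\mathcal X \text{ and } \mathbf a_0\in\bar{\mathcal A}(\mathbf x_0)\}.$$ For any $H\in\mathcal D^*$, $\max_{\mathbf a\in\bar{\mathcal A}(\tau)} I_H(\mathbf a,\omega,\tau)\le 0$ for every $\omega\in\Omega$ and $\tau\in\mathbb N=\{0,1,2,\dots\}$; consequently $\mathcal LH(\mathbf x)\le H(\mathbf x)$ for all $\mathbf x\in\mathcal X$. (c) (Strong duality) $V(\mathbf x)=\mathcal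 LV(\mathbf x)$ for all $\mathbf x\in\mathcal X$.
   Context: Weakly coupled dynamic program. Fix integers $N,L\ge1$, a discount factor $\beta\in(0,1)$ and $\mathbf b\in\mathbb R^L$. For $n=1,\dots,N$, project $n$ has a state space $\mathcal X^n$, action sets $\mathcal A^n(x^n)$ for $x^n\in\mathcal X^n$, a controlled transition kernel $P_n(\cdot\mid x^n,a^n)$, a bounded reward $R^n(x^n,a^n)\in\mathbb R$, and a constraint function $\mathbf B^n(x^n,a^n)\in\mathbb R^L$. Put $\mathcal X=\prod_n\mathcal X^n$, $\mathcal A(\mathbf x)=\prod_n\mathcal A^n(x^n)$, $R(\mathbf x,\mathbf a)=\sum_nR^n(x^n,a^n)$, $\mathbf B(\mathbf x,\mathbf a)=\sum_n\mathbf B^n(x^n,a^n)$, and $\bar{\mathcal A}(\mathbf x)=\{\mathbf a\in\mathcal A(\mathbf x):\mathbf B(\mathbf x,\mathbf a)\le\mathbf b\}$ (componentwise inequality). The joint transition law is the product $P(\cdot\mid\mathbf x,\mathbf a)=\prod_nP_n(\cdot\mid x^n,a^n)$, and $\mathbb E[H(\mathbf x_{t+1})\mid\mathbf x_t,\mathbf a_t]$ denotes the integral of $H$ against $P(\cdot\mid\mathbf x_t,\mathbf a_t)$. Scenarios. On a probability space $(\Omega,\mathcal F,P)$ the states are functions of the scenario $\omega$ and of the past controls: $\mathbf x_0=\mathbf x_0(\omega)$ and $\mathbf x_{t+1}=\mathbf x_{t+1}(\mathbf a(t),\omega)$ with $\mathbf a(t)=(\mathbf a_0,\dots,\mathbf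 a_t)$. Let $\mathcal F_0=\sigma\{\mathbf x_0\}$ and $\mathcal F_t=\sigma\{\mathbf x_0,\dots,\mathbf x_t,\mathbf a_0,\dots,\mathbf a_{t-1}\}$. A policy $\alpha$ selects for each $\omega$ a control sequence $(\mathbf a_0,\mathbf a_1,\dots)$ with $\mathbf a_t\in\bar{\mathcal A}(\mathbf x_t)$ for all $t$; it is non-anticipative if each $\mathbf a_t$ is $\mathcal F_t$-measurable; the set of these policies is $\bar{\mathbb A}_{\mathbb F}$. Under a non-anticipative policy the conditional law of $\mathbf x_{t+1}$ given $\mathcal F_t$ is $P(\cdot\mid\mathbf x_t,\mathbf a_t)$. Value. $V(\mathbf x_0;\alpha)=\mathbb E[\sum_{t\ge0}\beta^tR(\mathbf x_t,\mathbf a_t)\mid\mathbf x_0]$ and $V(\mathbf x_0)=\sup_{\alpha\in\bar{\mathbb A}_{\mathbb F}}V(\mathbf x_0;\alpha)$; the supremum is assumed to be attained, and $V$ satisfies the Bellman equation $V(\mathbf x_0)=\max_{\mathbf a_0\in\bar{\mathcal A}(\mathbf x_0)}\{R(\mathbf x_0,\mathbf a_0)+\beta\,\mathbb E[V(\mathbf x_1)\mid\mathbf x_0,\mathbf a_0]\}$. $\mathcal D$ is the set of bounded measurable functions $\mathcal X\to\mathbb R$. For a horizon $T\in\mathbb N$ and scenario $\omega$, $\bar{\mathcal A}(T)=\bar{\mathcal A}(\mathbf x_0)\times\cdots\times\bar{\mathcal A}(\mathbf x_T)$ is the set of $(\mathbf a_0,\dots,\mathbf a_T)$ with $\mathbf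 a_t\in\bar{\mathcal A}(\mathbf x_t)$ along the trajectory $\mathbf x_t=\mathbf x_t(\mathbf a(t-1),\omega)$ they generate; the maximum in $\mathcal LH$ is taken for each fixed $(\omega,\tau)$ (so $\mathbf a$ may depend on all of $\omega$ and on $\tau$), and the expectation is over both $\omega$ and $\tau$. Maxima written are assumed to exist and to be measurable in $\omega$ (as is the case, for example, when $\mathcal X$ and the action sets are finite). *)

theory Defs
  imports "HOL-Probability.Probability"
begin

text \<open>
  The projects are indexed by a finite type \<open>'n\<close> and the constraints by a finite type \<open>'l\<close>, so
  that \<open>N = CARD('n) \<ge> 1\<close> and \<open>L = CARD('l) \<ge> 1\<close>. State and action spaces of different projects
  may differ: they are measurable spaces whose carriers are subsets of common types
  \<open>'s\<close> and \<open>'a\<close>.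
\<close>

record ('n, 's, 'a, 'l::finite) wcdp =
  discount :: real
  budget :: "real ^ 'l"
  states :: "'n \<Rightarrow> 's measure"
  actions :: "'n \<Rightarrow> 'a measure"
  admissible :: "'n \<Rightarrow> 's \<Rightarrow> 'a set"
  kernel :: "'n \<Rightarrow> 's \<Rightarrow> 'a \<Rightarrow> 's measure"
  reward :: "'n \<Rightarrow> 's \<Rightarrow> 'a \<Rightarrow> real"
  consumption :: "'n \<Rightarrow> 's \<Rightarrow> 'a \<Rightarrow> real ^ 'l"

text \<open>
  \<open>traj m [a\<^sub>0, \<dots>, a\<^sub>t] \<omega>\<close> is the state at time \<open>t + 1\<close>, and \<open>traj m [] \<omega>\<close> the initial state.
  \<open>given_init m x\<close> is the conditional law of the scenario given that the initial state is \<open>x\<close>.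
\<close>

record ('n, 's, 'a, 'l::finite, 'w) scenario_wcdp = "('n, 's, 'a, 'l) wcdp" +
  scenarios :: "'w measure"
  traj :: "('n \<Rightarrow> 'a) list \<Rightarrow> 'w \<Rightarrow> ('n \<Rightarrow> 's)"
  given_init :: "('n \<Rightarrow> 's) \<Rightarrow> 'w measure"

definition joint_states :: "('n::finite, 's, 'a, 'l::finite, 'z) wcdp_scheme \<Rightarrow> ('n \<Rightarrow> 's) measure"
  where "joint_states m = PiM UNIV (states m)"

definition joint_actions :: "('n::finite, 's, 'a, 'l::finite, 'z) wcdp_scheme \<Rightarrow> ('n \<Rightarrow> 'a) measure"
  where "joint_actions m = PiM UNIV (actions m)"

definition joint_admissible ::
    "('n::finite, 's, 'a, 'l::finite, 'z) wcdp_scheme \<Rightarrow> ('n \<Rightarrow> 's) \<Rightarrow> ('n \<Rightarrow> 'a) set"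
  where "joint_admissible m x = (\<Pi>\<^sub>E n\<in>UNIV. admissible m n (x n))"

definition joint_reward ::
    "('n::finite, 's, 'a, 'l::finite, 'z) wcdp_scheme \<Rightarrow> ('n \<Rightarrow> 's) \<Rightarrow> ('n \<Rightarrow> 'a) \<Rightarrow> real"
  where "joint_reward m x a = (\<Sum>n\<in>UNIV. reward m n (x n) (a n))"

definition joint_consumption ::
    "('n::finite, 's, 'a, 'l::finite, 'z) wcdp_scheme \<Rightarrow> ('n \<Rightarrow> 's) \<Rightarrow> ('n \<Rightarrow> 'a) \<Rightarrow> real ^ 'l"
  where "joint_consumption m x a = (\<Sum>n\<in>UNIV. consumption m n (x n) (a n))"

definition feasible ::
    "('n::finite, 's, 'a, 'l::finite, 'z) wcdp_scheme \<Rightarrow> ('n \<Rightarrow> 's) \<Rightarrow> ('n \<Rightarrow> 'a) set"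
  where "feasible m x =
    {a \<in> joint_admissible m x. \<forall>l. joint_consumption m x a $ l \<le> budget m $ l}"

definition joint_kernel ::
    "('n::finite, 's, 'a, 'l::finite, 'z) wcdp_scheme \<Rightarrow> ('n \<Rightarrow> 's) \<Rightarrow> ('n \<Rightarrow> 'a) \<Rightarrow> ('n \<Rightarrow> 's) measure"
  where "joint_kernel m x a = PiM UNIV (\<lambda>n. kernel m n (x n) (a n))"

definition expected_next ::
    "('n::finite, 's, 'a, 'l::finite, 'z) wcdp_scheme \<Rightarrow> (('n \<Rightarrow> 's) \<Rightarrow> real)
      \<Rightarrow> ('n \<Rightarrow> 's) \<Rightarrow> ('n \<Rightarrow> 'a) \<Rightarrow> real"
  where "expected_next m H x a = (\<integral>y. H y \<partial>joint_kernel m x a)"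

text \<open>
  Rewards and kernels are only constrained at admissible state-action pairs, hence the
  restriction of the product space to the graph of the action correspondence.
\<close>

definition admissible_pairs ::
    "('n::finite, 's, 'a, 'l::finite, 'z) wcdp_scheme \<Rightarrow> 'n \<Rightarrow> ('s \<times> 'a) measure"
  where "admissible_pairs m n =
    restrict_space (states m n \<Otimes>\<^sub>M actions m n) {(x, a). a \<in> admissible m n x}"

definition is_wcdp :: "('n::finite, 's, 'a, 'l::finite, 'z) wcdp_scheme \<Rightarrow> bool"
  where "is_wcdp m \<longleftrightarrow>
    0 < discount m \<and> discount m < 1 \<and>
    (\<forall>n. \<forall>x\<in>space (states m n). admissible m n x \<subseteq> space (actions m n)) \<and>
    (\<forall>n. (\<lambda>(x, a). kernel m n x a) \<in> admissible_pairs m n \<rightarrow>\<^sub>M prob_algebra (states m n)) \<and>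
    (\<forall>n. (\<lambda>(x, a). reward m n x a) \<in> borel_measurable (admissible_pairs m n)) \<and>
    (\<forall>n. \<exists>C. \<forall>x\<in>space (states m n). \<forall>a\<in>admissible m n x. \<bar>reward m n x a\<bar> \<le> C)"

definition feasible_along ::
    "('n::finite, 's, 'a, 'l::finite, 'w, 'z) scenario_wcdp_scheme \<Rightarrow> 'w \<Rightarrow> ('n \<Rightarrow> 'a) list \<Rightarrow> bool"
  where "feasible_along m \<omega> as \<longleftrightarrow>
    (\<forall>t<length as. as ! t \<in> feasible m (traj m (take t as) \<omega>))"

definition feasible_upto ::
    "('n::finite, 's, 'a, 'l::finite, 'w, 'z) scenario_wcdp_scheme \<Rightarrow> 'w \<Rightarrow> nat \<Rightarrow> ('n \<Rightarrow> 'a) list set"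
  where "feasible_upto m \<omega> T = {as. length as = Suc T \<and> feasible_along m \<omega> as}"

text \<open>A policy \<open>\<alpha>\<close> selects in scenario \<open>\<omega>\<close> the controls \<open>\<alpha> \<omega> 0, \<alpha> \<omega> 1, \<dots>\<close>.\<close>

definition state_at ::
    "('n::finite, 's, 'a, 'l::finite, 'w, 'z) scenario_wcdp_scheme \<Rightarrow> ('w \<Rightarrow> nat \<Rightarrow> ('n \<Rightarrow> 'a))
      \<Rightarrow> nat \<Rightarrow> 'w \<Rightarrow> ('n \<Rightarrow> 's)"
  where "state_at m \<alpha> t \<omega> = traj m (map (\<alpha> \<omega>) [0..<t]) \<omega>"

definition history ::
    "('n::finite, 's, 'a, 'l::finite, 'w, 'z) scenario_wcdp_scheme \<Rightarrow> ('w \<Rightarrow> nat \<Rightarrow> ('n \<Rightarrow> 'a))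
      \<Rightarrow> nat \<Rightarrow> 'w measure"
  where "history m \<alpha> t = sigma (space (scenarios m))
    ({state_at m \<alpha> i -` D \<inter> space (scenarios m) | i D. i \<le> t \<and> D \<in> sets (joint_states m)} \<union>
     {(\<lambda>\<omega>. \<alpha> \<omega> i) -` D \<inter> space (scenarios m) | i D. i < t \<and> D \<in> sets (joint_actions m)})"

definition policies ::
    "('n::finite, 's, 'a, 'l::finite, 'w, 'z) scenario_wcdp_scheme \<Rightarrow> ('w \<Rightarrow> nat \<Rightarrow> ('n \<Rightarrow> 'a)) set"
  where "policies m = {\<alpha>.
    (\<forall>\<omega>\<in>space (scenarios m). \<forall>t. \<alpha> \<omega> t \<in> feasible m (state_at m \<alpha> t \<omega>)) \<and>
    (\<forall>t. (\<lambda>\<omega>. \<alpha> \<omega> t) \<in> history m \<alpha> t \<rightarrow>\<^sub>M joint_actions m)}"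

text \<open>
  The fourth to sixth conditions say that \<open>given_init m\<close> is a regular conditional probability
  given the initial state: for integrable \<open>Y\<close>, integrating \<open>Y\<close> against
  \<open>given_init m (traj m [] \<omega>)\<close> gives a version of the conditional expectation of \<open>Y\<close> given the
  initial state. Having a law for every \<open>x\<close> in the state space, not only for almost every one,
  makes conditional expectations given the initial state meaningful pointwise. The last condition
  says that under every such law the conditional law of the next state given the history is
  the transition law; this implies the same property under the law of \<open>scenarios m\<close>.
\<close>

definition is_scenario_wcdp ::
    "('n::finite, 's, 'a, 'l::finite, 'w, 'z) scenario_wcdp_scheme \<Rightarrow> bool"
  where "is_scenario_wcdp m \<longleftrightarrow>
    is_wcdp m \<and>
    prob_space (scenarios m) \<and>
    traj m [] \<in> scenarios m \<rightarrow>\<^sub>M joint_states m \<and>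
    given_init m \<in> joint_states m \<rightarrow>\<^sub>M prob_algebra (scenarios m) \<and>
    (\<forall>x\<in>space (joint_states m). AE \<omega> in given_init m x. traj m [] \<omega> = x) \<and>
    (\<forall>E\<in>sets (scenarios m). emeasure (scenarios m) E =
        (\<integral>\<^sup>+\<omega>. emeasure (given_init m (traj m [] \<omega>)) E \<partial>scenarios m)) \<and>
    (\<forall>\<omega>\<in>space (scenarios m). \<forall>as. feasible_along m \<omega> as \<longrightarrow> traj m as \<omega> \<in> space (joint_states m)) \<and>
    (\<forall>\<alpha>\<in>policies m. \<forall>t. state_at m \<alpha> t \<in> scenarios m \<rightarrow>\<^sub>M joint_states m) \<and>
    (\<forall>x\<in>space (joint_states m). \<forall>\<alpha>\<in>policies m. \<forall>t. \<forall>D\<in>sets (joint_states m).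
        AE \<omega> in given_init m x.
          real_cond_exp (given_init m x) (history m \<alpha> t)
            (\<lambda>\<omega>'. indicator D (state_at m \<alpha> (Suc t) \<omega>')) \<omega>
          = measure (joint_kernel m (state_at m \<alpha> t \<omega>) (\<alpha> \<omega> t)) D)"

definition policy_value ::
    "('n::finite, 's, 'a, 'l::finite, 'w, 'z) scenario_wcdp_scheme \<Rightarrow> ('w \<Rightarrow> nat \<Rightarrow> ('n \<Rightarrow> 'a))
      \<Rightarrow> ('n \<Rightarrow> 's) \<Rightarrow> real"
  where "policy_value m \<alpha> x =
    (\<integral>\<omega>. (\<Sum>t. discount m ^ t * joint_reward m (state_at m \<alpha> t \<omega>) (\<alpha> \<omega> t)) \<partial>given_init m x)"

definition opt_value ::
    "('n::finite, 's, 'a, 'l::finite, 'w, 'z) scenario_wcdp_scheme \<Rightarrow> ('n \<Rightarrow> 's) \<Rightarrow> real"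
  where "opt_value m x = (SUP \<alpha>\<in>policies m. policy_value m \<alpha> x)"

definition value_attained ::
    "('n::finite, 's, 'a, 'l::finite, 'w, 'z) scenario_wcdp_scheme \<Rightarrow> bool"
  where "value_attained m \<longleftrightarrow>
    (\<forall>x\<in>space (joint_states m). \<exists>\<alpha>\<in>policies m. policy_value m \<alpha> x = opt_value m x)"

definition has_maximum :: "('b \<Rightarrow> real) \<Rightarrow> 'b set \<Rightarrow> bool"
  where "has_maximum f S \<longleftrightarrow> (\<exists>a\<in>S. \<forall>b\<in>S. f b \<le> f a)"

definition maximum :: "('b \<Rightarrow> real) \<Rightarrow> 'b set \<Rightarrow> real"
  where "maximum f S = (GREATEST v. v \<in> f ` S)"

text \<open>Measurability of the optimal value is what makes its expectation in the equation meaningful.\<close>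

definition bellman_equation ::
    "('n::finite, 's, 'a, 'l::finite, 'w, 'z) scenario_wcdp_scheme \<Rightarrow> bool"
  where "bellman_equation m \<longleftrightarrow>
    opt_value m \<in> borel_measurable (joint_states m) \<and>
    (\<forall>x\<in>space (joint_states m).
      has_maximum (\<lambda>a. joint_reward m x a + discount m * expected_next m (opt_value m) x a)
        (feasible m x) \<and>
      opt_value m x =
        maximum (\<lambda>a. joint_reward m x a + discount m * expected_next m (opt_value m) x a)
          (feasible m x))"

definition bounded_measurable ::
    "('n::finite, 's, 'a, 'l::finite, 'z) wcdp_scheme \<Rightarrow> (('n \<Rightarrow> 's) \<Rightarrow> real) set"
  where "bounded_measurable m = {H \<in> borel_measurable (joint_states m).
    \<exists>C. \<forall>x\<in>space (joint_states m). \<bar>H x\<bar> \<le> C}"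

definition supersolutions ::
    "('n::finite, 's, 'a, 'l::finite, 'z) wcdp_scheme \<Rightarrow> (('n \<Rightarrow> 's) \<Rightarrow> real) set"
  where "supersolutions m = {H \<in> bounded_measurable m.
    \<forall>x\<in>space (joint_states m). \<forall>a\<in>feasible m x.
      joint_reward m x a + discount m * expected_next m H x a \<le> H x}"

definition penalized_reward ::
    "('n::finite, 's, 'a, 'l::finite, 'w, 'z) scenario_wcdp_scheme \<Rightarrow> (('n \<Rightarrow> 's) \<Rightarrow> real)
      \<Rightarrow> ('n \<Rightarrow> 'a) list \<Rightarrow> 'w \<Rightarrow> nat \<Rightarrow> real"
  where "penalized_reward m H as \<omega> T =
    (\<Sum>t\<le>T. let x = traj m (take t as) \<omega>; a = as ! t in
      joint_reward m x a + discount m * expected_next m H x a - H x)"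

definition max_penalized_reward ::
    "('n::finite, 's, 'a, 'l::finite, 'w, 'z) scenario_wcdp_scheme \<Rightarrow> (('n \<Rightarrow> 's) \<Rightarrow> real)
      \<Rightarrow> 'w \<Rightarrow> nat \<Rightarrow> real"
  where "max_penalized_reward m H \<omega> T =
    maximum (\<lambda>as. penalized_reward m H as \<omega> T) (feasible_upto m \<omega> T)"

definition maxima_exist_measurable ::
    "('n::finite, 's, 'a, 'l::finite, 'w, 'z) scenario_wcdp_scheme \<Rightarrow> (('n \<Rightarrow> 's) \<Rightarrow> real) \<Rightarrow> bool"
  where "maxima_exist_measurable m H \<longleftrightarrow>
    (\<forall>T. \<forall>\<omega>\<in>space (scenarios m).
      has_maximum (\<lambda>as. penalized_reward m H as \<omega> T) (feasible_upto m \<omega> T)) \<and>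
    (\<forall>T. (\<lambda>\<omega>. max_penalized_reward m H \<omega> T) \<in> borel_measurable (scenarios m))"

text \<open>
  The random time has mass \<open>(1 - \<beta>) * \<beta> ^ t\<close> at \<open>t\<close> and is independent of the scenario: given the
  initial state, the joint law of scenario and random time is a product measure.
\<close>

definition dual_bound ::
    "('n::finite, 's, 'a, 'l::finite, 'w, 'z) scenario_wcdp_scheme \<Rightarrow> (('n \<Rightarrow> 's) \<Rightarrow> real)
      \<Rightarrow> ('n \<Rightarrow> 's) \<Rightarrow> real"
  where "dual_bound m H x = H x +
    (\<integral>(\<omega>, T). max_penalized_reward m H \<omega> T
      \<partial>(given_init m x \<Otimes>\<^sub>M measure_pmf (geometric_pmf (1 - discount m))))"

end

theory Submission
  imports Defs
begin

text \<open>
  Write \<open>\<beta>\<close> for the discount factor and \<open>V\<close> for the optimal value. The whole argument rests on one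
  quantity, the gap \<open>g(x, a) = R(x, a) + \<beta> E[H(x') | x, a] - H(x)\<close> of the Bellman inequality for a
  candidate value function \<open>H\<close>: the penalized reward up to time \<open>T\<close> is the sum of the gaps at the
  times \<open>0, \<dots>, T\<close>.

  A time \<open>t\<close> contributes to a sum stopped at the geometric time exactly when that time is at least
  \<open>t\<close>, which has probability \<open>\<beta> ^ t\<close>; so stopping at the random time replaces discounting
  (\<open>geometric_partial_sums\<close>). Along a non-anticipative policy, \<open>E[H(x') | x, a]\<close> has the same mean
  as \<open>H\<close> at the next state (\<open>expectation_next_state\<close>), so the discounted mean gaps telescope: they add
  up to the value of the policy minus \<open>H\<close> at the initial state (\<open>value_eq_discounted_gaps\<close>). Hence
  the mean of the penalized reward of the policy, stopped at the random time, does not depend on \<open>H\<close>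
  apart from the term \<open>- H(x)\<close> that the dual bound adds back. In each scenario the controls of the
  policy are one of the feasible sequences over which the dual bound maximizes with hindsight, and
  this gives weak duality (\<open>weak_duality\<close>) for an optimal policy, which exists by assumption.

  If \<open>H\<close> satisfies the Bellman inequality, all gaps at feasible pairs are at most \<open>0\<close>, and so is every
  penalized reward: the dual bound is then at most \<open>H\<close>. By the Bellman equation \<open>V\<close> itself is such a
  function, and the two inequalities together give strong duality.
\<close>

section \<open>Geometric random times\<close>

text \<open>
  The mass \<open>(1 - \<beta>) * \<beta> ^ T\<close> times the partial sum up to \<open>T\<close> is, up to the factor \<open>1 - \<beta>\<close>, the
  \<open>T\<close>-th term of the Cauchy product of the discounted series with the geometric series. The sum
  \<open>1 / (1 - \<beta>)\<close> of the latter cancels that factor.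
\<close>

lemma geometric_partial_sums:
  fixes e :: "nat \<Rightarrow> real"
  assumes "0 < \<beta>" "\<beta> < 1" and bound: "\<And>t. \<bar>e t\<bar> \<le> C"
  shows "(\<integral>T. (\<Sum>t\<le>T. e t) \<partial>measure_pmf (geometric_pmf (1 - \<beta>))) = (\<Sum>t. \<beta> ^ t * e t)"
proof -
  define S where "S T = (\<Sum>t\<le>T. e t)" for T
  have pmf: "pmf (geometric_pmf (1 - \<beta>)) T = (1 - \<beta>) * \<beta> ^ T" for T
    using assms by (simp add: mult.commute)
  have abs_summable: "summable (\<lambda>t. norm (\<beta> ^ t * d t))" if "\<And>t. \<bar>d t\<bar> \<le> D" for d :: "nat \<Rightarrow> real" and D
  proof (rule summable_comparison_test')
    show "summable (\<lambda>t. \<beta> ^ t * D)"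
      using assms by (intro summable_mult2 summable_geometric) auto
    show "norm (norm (\<beta> ^ t * d t)) \<le> \<beta> ^ t * D" for t
      using assms that[of t] by (simp add: abs_mult mult_left_mono)
  qed
  have partial_sums_sums: "(\<lambda>T. \<beta> ^ T * (\<Sum>t\<le>T. d t)) sums ((\<Sum>t. \<beta> ^ t * d t) / (1 - \<beta>))"
    if "\<And>t. \<bar>d t\<bar> \<le> D" for d :: "nat \<Rightarrow> real" and D
  proof -
    have "(\<lambda>T. \<Sum>t\<le>T. (\<beta> ^ t * d t) * \<beta> ^ (T - t)) sums ((\<Sum>t. \<beta> ^ t * d t) * (\<Sum>k. \<beta> ^ k))"
      using abs_summable[OF that] assms
      by (intro Cauchy_product_sums) (auto simp: norm_power intro!: summable_geometric)
    moreover have "(\<Sum>t\<le>T. (\<beta> ^ t * d t) * \<beta> ^ (T - t)) = \<beta> ^ T * (\<Sum>t\<le>T. d t)" for T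
      by (auto simp: sum_distrib_left mult.assoc mult.left_commute simp flip: power_add intro!: sum.cong)
    ultimately show ?thesis
      using assms by (simp add: suminf_geometric)
  qed
  have "summable (\<lambda>T. norm (pmf (geometric_pmf (1 - \<beta>)) T * S T))"
  proof (rule summable_comparison_test')
    show "summable (\<lambda>T. (1 - \<beta>) * (\<beta> ^ T * (\<Sum>t\<le>T. \<bar>e t\<bar>)))"
      using partial_sums_sums[of "\<lambda>t. \<bar>e t\<bar>" C] bound
      by (intro summable_mult) (auto simp: sums_iff)
    show "norm (norm (pmf (geometric_pmf (1 - \<beta>)) T * S T)) \<le> (1 - \<beta>) * (\<beta> ^ T * (\<Sum>t\<le>T. \<bar>e t\<bar>))" for T
      using assms sum_abs[of e "{..T}"]
      by (simp add: pmf abs_mult S_def mult.assoc mult_left_mono)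
  qed
  then have "integrable (count_space UNIV) (\<lambda>T. pmf (geometric_pmf (1 - \<beta>)) T * S T)"
    unfolding integrable_count_space_nat_iff .
  then have "(\<integral>T. pmf (geometric_pmf (1 - \<beta>)) T * S T \<partial>count_space UNIV) =
      (\<Sum>T. pmf (geometric_pmf (1 - \<beta>)) T * S T)"
    by (rule integral_count_space_nat)
  also have "\<dots> = (1 - \<beta>) * (\<Sum>T. \<beta> ^ T * S T)"
    using partial_sums_sums[of e C, OF bound]
    by (subst suminf_mult[symmetric]) (auto simp: pmf S_def mult.assoc sums_iff)
  also have "\<dots> = (\<Sum>t. \<beta> ^ t * e t)"
    using partial_sums_sums[of e C, OF bound] assms by (simp add: S_def sums_iff)
  finally show ?thesis
    unfolding measure_pmf_eq_density S_def by (subst integral_density) auto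
qed

text \<open>
  The integral of a function that is not integrable is \<open>0\<close> by convention. The bound covers that
  case because a probability space is not empty, which forces \<open>0 \<le> C\<close>.
\<close>

lemma (in prob_space) abs_expectation_le:
  fixes f :: "'a \<Rightarrow> real"
  assumes bound: "\<And>x. x \<in> space M \<Longrightarrow> \<bar>f x\<bar> \<le> C"
  shows "\<bar>expectation f\<bar> \<le> C"
proof (cases "integrable M f")
  case True
  then have "\<bar>expectation f\<bar> \<le> expectation (\<lambda>x. \<bar>f x\<bar>)"
    using integral_norm_bound[of M f] by simp
  also have "\<dots> \<le> expectation (\<lambda>_. C)"
    using True bound by (intro integral_mono) auto
  finally show ?thesis by (simp add: prob_space)
next
  case False
  obtain x where "x \<in> space M"
    using not_empty by blast
  with bound[of x] have "0 \<le> C"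
    using abs_ge_zero[of "f x"] by linarith
  with False show ?thesis
    by (simp add: not_integrable_integral_eq)
qed

text \<open>
  A geometric time has finite mean, so growth at most linear in time, uniformly in the scenario,
  gives integrability. Penalized rewards are sums of \<open>T + 1\<close> bounded terms and grow in this way.
\<close>

lemma (in prob_space) integrable_geometric_time:
  fixes f :: "'a \<times> nat \<Rightarrow> real"
  assumes "0 < \<beta>" "\<beta> < 1"
    and meas: "\<And>T. (\<lambda>\<omega>. f (\<omega>, T)) \<in> borel_measurable M"
    and bound: "\<And>\<omega> T. \<omega> \<in> space M \<Longrightarrow> \<bar>f (\<omega>, T)\<bar> \<le> C * (real T + 1)"
  shows "integrable (M \<Otimes>\<^sub>M measure_pmf (geometric_pmf (1 - \<beta>))) f"
proof -
  let ?\<tau> = "measure_pmf (geometric_pmf (1 - \<beta>))"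
  interpret pair_sigma_finite M ?\<tau> ..
  have linear_int: "integrable ?\<tau> (\<lambda>T. C * (real T + 1))"
    using assms integrable_real_geometric_pmf[of "1 - \<beta>"] by simp
  have "integrable (M \<Otimes>\<^sub>M ?\<tau>) (\<lambda>(\<omega>, T). C * (real T + 1))"
  proof (rule Fubini_integrable)
    show "(\<lambda>(\<omega>, T). C * (real T + 1)) \<in> borel_measurable (M \<Otimes>\<^sub>M ?\<tau>)"
      by measurable
  qed (use linear_int in simp_all)
  moreover have "f \<in> borel_measurable (M \<Otimes>\<^sub>M ?\<tau>)"
  proof -
    have "(\<lambda>z. f (fst z, snd z)) \<in> borel_measurable (M \<Otimes>\<^sub>M ?\<tau>)"
    proof (rule measurable_compose_countable[of "\<lambda>T z. f (fst z, T)"])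
      show "(\<lambda>z. f (fst z, T)) \<in> borel_measurable (M \<Otimes>\<^sub>M ?\<tau>)" for T
        by (rule measurable_compose[OF measurable_fst meas])
    qed measurable
    then show ?thesis by simp
  qed
  ultimately show ?thesis
  proof (rule Bochner_Integration.integrable_bound)
    show "AE z in M \<Otimes>\<^sub>M ?\<tau>. norm (f z) \<le> norm (case z of (\<omega>, T) \<Rightarrow> C * (real T + 1))"
      using bound by (intro AE_I2) (auto simp: space_pair_measure intro: order_trans[OF _ abs_ge_self])
  qed
qed

section \<open>Measurability of a product of kernels\<close>

text \<open>
  Boxes are stable under intersection and generate the product \<open>\<sigma>\<close>-algebra, so measurability only has
  to be tested on them, where the product measure is a finite product of measurable functions.
\<close>

lemma measurable_PiM_prob_algebra:
  fixes K :: "'b \<Rightarrow> 'n::finite \<Rightarrow> 's measure"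
  assumes K: "\<And>n. (\<lambda>z. K z n) \<in> M \<rightarrow>\<^sub>M prob_algebra (N n)"
  shows "(\<lambda>z. PiM UNIV (K z)) \<in> M \<rightarrow>\<^sub>M prob_algebra (PiM UNIV N)"
proof (rule measurable_prob_algebra_generated[OF sets_PiM Int_stable_prod_algebra
      prod_algebra_sets_into_space])
  fix z assume "z \<in> space M"
  then have "K z n \<in> space (prob_algebra (N n))" for n
    using measurable_space[OF K] by auto
  then have prob: "prob_space (K z n)" and sets: "sets (K z n) = sets (N n)" for n
    by (auto simp: space_prob_algebra)
  show "prob_space (PiM UNIV (K z))"
    using prob by (intro prob_space_PiM)
  show "sets (PiM UNIV (K z)) = sets (PiM UNIV N)"
    using sets by (intro sets_PiM_cong) auto
next
  fix A assume "A \<in> prod_algebra UNIV N"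
  then obtain E where A: "A = Pi\<^sub>E UNIV E" and E: "\<And>n. E n \<in> sets (N n)"
    by (auto elim!: prod_algebraE_all)
  have "emeasure (PiM UNIV (K z)) A = (\<Prod>n\<in>UNIV. emeasure (K z n) (E n))" if "z \<in> space M" for z
  proof -
    have K_z: "K z n \<in> space (prob_algebra (N n))" for n
      using that measurable_space[OF K] by auto
    interpret product_prob_space "K z"
      using K_z by (intro product_prob_spaceI) (auto simp: space_prob_algebra)
    show ?thesis
      unfolding A using K_z E by (intro emeasure_PiM) (auto simp: space_prob_algebra)
  qed
  moreover have "(\<lambda>z. emeasure (K z n) (E n)) \<in> borel_measurable M" for n
    using measurable_prob_algebraD[OF K[of n]] E[of n]
    by (rule measurable_compose[OF _ measurable_emeasure_subprob_algebra])
  ultimately show "(\<lambda>z. emeasure (PiM UNIV (K z)) A) \<in> borel_measurable M"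
    by (subst measurable_cong[where g = "\<lambda>z. \<Prod>n\<in>UNIV. emeasure (K z n) (E n)"]) auto
qed

section \<open>Attained maxima\<close>

lemma
  assumes "has_maximum f S"
  shows maximum_in_image: "maximum f S \<in> f ` S"
    and maximum_upper: "b \<in> S \<Longrightarrow> f b \<le> maximum f S"
proof -
  obtain a where a: "a \<in> S" "\<And>b. b \<in> S \<Longrightarrow> f b \<le> f a"
    using assms by (auto simp: has_maximum_def)
  then have "maximum f S = f a"
    unfolding maximum_def by (intro Greatest_equality) auto
  with a show "maximum f S \<in> f ` S" "b \<in> S \<Longrightarrow> f b \<le> maximum f S"
    by auto
qed

section \<open>Feasible state-action pairs\<close>

text \<open>
  Kernels and rewards are assumed measurable only on the graphs of the action sets of the
  projects, hence statements on joint measurability are made on the graph of the feasible actions.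
\<close>

definition feasible_pairs ::
    "('n::finite, 's, 'a, 'l::finite, 'z) wcdp_scheme \<Rightarrow> (('n \<Rightarrow> 's) \<times> ('n \<Rightarrow> 'a)) measure"
  where "feasible_pairs m =
    restrict_space (joint_states m \<Otimes>\<^sub>M joint_actions m) {(x, a). a \<in> feasible m x}"

text \<open>
  The amount by which acting with \<open>a\<close> for one step and then collecting \<open>H\<close>, discounted and in
  expectation, exceeds \<open>H\<close> at the current state.
  It is at most \<open>0\<close> at all feasible pairs precisely when \<open>H\<close> satisfies the Bellman inequality.
\<close>

definition bellman_gap ::
    "('n::finite, 's, 'a, 'l::finite, 'z) wcdp_scheme \<Rightarrow> (('n \<Rightarrow> 's) \<Rightarrow> real)
      \<Rightarrow> ('n \<Rightarrow> 's) \<Rightarrow> ('n \<Rightarrow> 'a) \<Rightarrow> real"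
  where "bellman_gap m H x a = joint_reward m x a + discount m * expected_next m H x a - H x"

lemma penalized_reward_eq_gaps:
  "penalized_reward m H as \<omega> T = (\<Sum>t\<le>T. bellman_gap m H (traj m (take t as) \<omega>) (as ! t))"
  by (simp add: penalized_reward_def bellman_gap_def Let_def)

locale coupled_program =
  fixes m :: "('n::finite, 's, 'a, 'l::finite, 'z) wcdp_scheme"
  assumes wcdp: "is_wcdp m"
begin

lemma discount_bounds: "0 < discount m" "discount m < 1"
  using wcdp by (auto simp: is_wcdp_def)

lemma feasible_in_joint_actions:
  assumes "x \<in> space (joint_states m)" "a \<in> feasible m x"
  shows "a \<in> space (joint_actions m)"
  using assms wcdp
  by (fastforce simp: is_wcdp_def feasible_def joint_admissible_def joint_states_def
      joint_actions_def space_PiM PiE_iff)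

lemma space_feasible_pairs:
  "(x, a) \<in> space (feasible_pairs m) \<longleftrightarrow> x \<in> space (joint_states m) \<and> a \<in> feasible m x"
  using feasible_in_joint_actions
  by (auto simp: feasible_pairs_def space_restrict_space space_pair_measure)

lemma measurable_project_pair:
  "(\<lambda>(x, a). (x n, a n)) \<in> feasible_pairs m \<rightarrow>\<^sub>M admissible_pairs m n"
  unfolding admissible_pairs_def
proof (rule measurable_restrict_space2)
  show "(\<lambda>(x, a). (x n, a n)) \<in> space (feasible_pairs m) \<rightarrow> {(x, a). a \<in> admissible m n x}"
    by (auto simp: space_feasible_pairs feasible_def joint_admissible_def PiE_iff)
  show "(\<lambda>(x, a). (x n, a n)) \<in> feasible_pairs m \<rightarrow>\<^sub>M states m n \<Otimes>\<^sub>M actions m n"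
    unfolding feasible_pairs_def joint_states_def joint_actions_def
    by (rule measurable_restrict_space1) measurable
qed

lemma measurable_joint_kernel:
  "(\<lambda>(x, a). joint_kernel m x a) \<in> feasible_pairs m \<rightarrow>\<^sub>M prob_algebra (joint_states m)"
proof -
  have "(\<lambda>z. kernel m n (fst z n) (snd z n)) \<in> feasible_pairs m \<rightarrow>\<^sub>M prob_algebra (states m n)" for n
  proof -
    have "(\<lambda>(x, a). kernel m n x a) \<in> admissible_pairs m n \<rightarrow>\<^sub>M prob_algebra (states m n)"
      using wcdp by (auto simp: is_wcdp_def)
    from measurable_compose[OF measurable_project_pair this] show ?thesis
      by (simp add: case_prod_beta')
  qed
  from measurable_PiM_prob_algebra[OF this] show ?thesis
    by (simp add: joint_kernel_def joint_states_def case_prod_beta')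
qed

lemma measurable_joint_reward:
  "(\<lambda>(x, a). joint_reward m x a) \<in> borel_measurable (feasible_pairs m)"
proof -
  have "(\<lambda>z. reward m n (fst z n) (snd z n)) \<in> borel_measurable (feasible_pairs m)" for n
  proof -
    have "(\<lambda>(x, a). reward m n x a) \<in> borel_measurable (admissible_pairs m n)"
      using wcdp by (auto simp: is_wcdp_def)
    from measurable_compose[OF measurable_project_pair this] show ?thesis
      by (simp add: case_prod_beta')
  qed
  then show ?thesis
    by (simp add: joint_reward_def case_prod_beta' borel_measurable_sum)
qed

lemma measurable_expected_next:
  assumes "H \<in> borel_measurable (joint_states m)"
  shows "(\<lambda>(x, a). expected_next m H x a) \<in> borel_measurable (feasible_pairs m)"
  using measurable_compose[OF measurable_prob_algebraD[OF measurable_joint_kernel]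
      integral_measurable_subprob_algebra[OF assms]]
  by (simp add: expected_next_def case_prod_beta')

lemma measurable_bellman_gap:
  assumes "H \<in> borel_measurable (joint_states m)"
  shows "(\<lambda>(x, a). bellman_gap m H x a) \<in> borel_measurable (feasible_pairs m)"
proof -
  have "(\<lambda>z. H (fst z)) \<in> borel_measurable (feasible_pairs m)"
    unfolding feasible_pairs_def
    by (rule measurable_restrict_space1) (rule measurable_compose[OF measurable_fst assms])
  with measurable_joint_reward measurable_expected_next[OF assms] show ?thesis
    by (simp add: bellman_gap_def case_prod_beta')
qed

lemma joint_reward_bounded:
  "\<exists>C. \<forall>x\<in>space (joint_states m). \<forall>a\<in>feasible m x. \<bar>joint_reward m x a\<bar> \<le> C"
proof -
  obtain C where C: "\<And>n x a. x \<in> space (states m n) \<Longrightarrow> a \<in> admissible m n x \<Longrightarrow> \<bar>reward m n x a\<bar> \<le> C n"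
    using wcdp unfolding is_wcdp_def by metis
  show ?thesis
  proof (intro exI ballI)
    fix x a assume "x \<in> space (joint_states m)" "a \<in> feasible m x"
    then have "\<bar>reward m n (x n) (a n)\<bar> \<le> C n" for n
      by (intro C) (auto simp: joint_states_def space_PiM feasible_def joint_admissible_def PiE_iff)
    then show "\<bar>joint_reward m x a\<bar> \<le> (\<Sum>n\<in>UNIV. C n)"
      unfolding joint_reward_def by (intro order_trans[OF sum_abs] sum_mono)
  qed
qed

lemma expected_next_bounded:
  assumes "\<And>y. y \<in> space (joint_states m) \<Longrightarrow> \<bar>H y\<bar> \<le> C"
    and "x \<in> space (joint_states m)" "a \<in> feasible m x"
  shows "\<bar>expected_next m H x a\<bar> \<le> C"
proof -
  have K: "joint_kernel m x a \<in> space (prob_algebra (joint_states m))"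
    using measurable_space[OF measurable_joint_kernel, of "(x, a)"] assms
    by (auto simp: space_feasible_pairs)
  then interpret prob_space "joint_kernel m x a"
    by (simp add: space_prob_algebra)
  have "space (joint_kernel m x a) = space (joint_states m)"
    using K by (auto simp: space_prob_algebra dest: sets_eq_imp_space_eq)
  then show ?thesis
    unfolding expected_next_def using assms(1) by (intro abs_expectation_le) auto
qed

lemma bellman_gap_bounded:
  assumes "H \<in> bounded_measurable m"
  shows "\<exists>C. \<forall>x\<in>space (joint_states m). \<forall>a\<in>feasible m x. \<bar>bellman_gap m H x a\<bar> \<le> C"
proof -
  obtain C where C: "\<And>x. x \<in> space (joint_states m) \<Longrightarrow> \<bar>H x\<bar> \<le> C"
    using assms by (auto simp: bounded_measurable_def)
  obtain D where D: "\<And>x a. x \<in> space (joint_states m) \<Longrightarrow> a \<in> feasible m x \<Longrightarrow> \<bar>joint_reward m x a\<bar> \<le> D"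
    using joint_reward_bounded by blast
  show ?thesis
  proof (intro exI ballI)
    fix x a assume xa: "x \<in> space (joint_states m)" "a \<in> feasible m x"
    have "\<bar>discount m * expected_next m H x a\<bar> \<le> discount m * C"
      using discount_bounds expected_next_bounded[OF C xa] by (simp add: abs_mult)
    with C[OF xa(1)] D[OF xa] show "\<bar>bellman_gap m H x a\<bar> \<le> D + discount m * C + C"
      unfolding bellman_gap_def by linarith
  qed
qed

end


section \<open>Feasible control sequences and policies\<close>

locale scenario_program =
  fixes m :: "('n::finite, 's, 'a, 'l::finite, 'w, 'z) scenario_wcdp_scheme"
  assumes scenario_wcdp: "is_scenario_wcdp m"
begin

sublocale coupled_program m
  using scenario_wcdp unfolding is_scenario_wcdp_def by unfold_locales (elim conjE)

lemma measurable_given_init: "given_init m \<in> joint_states m \<rightarrow>\<^sub>M prob_algebra (scenarios m)"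
  and initial_state: "\<forall>x\<in>space (joint_states m). AE \<omega> in given_init m x. traj m [] \<omega> = x"
  and traj_in_states: "\<forall>\<omega>\<in>space (scenarios m). \<forall>as. feasible_along m \<omega> as \<longrightarrow>
    traj m as \<omega> \<in> space (joint_states m)"
  and measurable_states: "\<forall>\<alpha>\<in>policies m. \<forall>t. state_at m \<alpha> t \<in> scenarios m \<rightarrow>\<^sub>M joint_states m"
  and transition_law: "\<forall>x\<in>space (joint_states m). \<forall>\<alpha>\<in>policies m. \<forall>t. \<forall>D\<in>sets (joint_states m).
    AE \<omega> in given_init m x.
      real_cond_exp (given_init m x) (history m \<alpha> t)
        (\<lambda>\<omega>'. indicator D (state_at m \<alpha> (Suc t) \<omega>')) \<omega>
      = measure (joint_kernel m (state_at m \<alpha> t \<omega>) (\<alpha> \<omega> t)) D"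
  using scenario_wcdp unfolding is_scenario_wcdp_def atomize_conj by (elim conjE, intro conjI)

lemma given_init_prob_algebra:
  "x \<in> space (joint_states m) \<Longrightarrow> given_init m x \<in> space (prob_algebra (scenarios m))"
  using measurable_space[OF measurable_given_init] .

lemma prob_space_given_init: "x \<in> space (joint_states m) \<Longrightarrow> prob_space (given_init m x)"
  and sets_given_init: "x \<in> space (joint_states m) \<Longrightarrow> sets (given_init m x) = sets (scenarios m)"
  using given_init_prob_algebra by (auto simp: space_prob_algebra)

lemma space_given_init: "x \<in> space (joint_states m) \<Longrightarrow> space (given_init m x) = space (scenarios m)"
  using sets_given_init by (rule sets_eq_imp_space_eq)

lemma feasible_along_step:
  assumes "\<omega> \<in> space (scenarios m)" "feasible_along m \<omega> as" "t < length as"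
  shows "traj m (take t as) \<omega> \<in> space (joint_states m)"
    and "as ! t \<in> feasible m (traj m (take t as) \<omega>)"
proof -
  have "feasible_along m \<omega> (take t as)"
    using assms by (auto simp: feasible_along_def min_def)
  then show "traj m (take t as) \<omega> \<in> space (joint_states m)"
    using assms traj_in_states by blast
  show "as ! t \<in> feasible m (traj m (take t as) \<omega>)"
    using assms by (auto simp: feasible_along_def)
qed

text \<open>
  The controls that a policy uses form a feasible sequence in every single scenario. This is why
  hindsight optimization dominates every policy.
\<close>

lemma policy_controls_feasible_along:
  assumes "\<alpha> \<in> policies m" "\<omega> \<in> space (scenarios m)"
  shows "feasible_along m \<omega> (map (\<alpha> \<omega>) [0..<t])"
  using assms by (auto simp: feasible_along_def policies_def state_at_def take_map)

lemma policy_pair_feasible: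
  assumes "\<alpha> \<in> policies m" "\<omega> \<in> space (scenarios m)"
  shows "state_at m \<alpha> t \<omega> \<in> space (joint_states m)" "\<alpha> \<omega> t \<in> feasible m (state_at m \<alpha> t \<omega>)"
  using assms policy_controls_feasible_along[OF assms] traj_in_states
  by (auto simp: policies_def state_at_def)

lemma measurable_state_at:
  "\<alpha> \<in> policies m \<Longrightarrow> state_at m \<alpha> t \<in> scenarios m \<rightarrow>\<^sub>M joint_states m"
  using measurable_states by blast

lemma space_history: "space (history m \<alpha> t) = space (scenarios m)"
  unfolding history_def by (intro space_measure_of) auto

lemma sets_history_subset:
  assumes "\<alpha> \<in> policies m" "\<And>i. i < t \<Longrightarrow> (\<lambda>\<omega>. \<alpha> \<omega> i) \<in> scenarios m \<rightarrow>\<^sub>M joint_actions m"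
  shows "sets (history m \<alpha> t) \<subseteq> sets (scenarios m)"
proof -
  have "sets (history m \<alpha> t) = sigma_sets (space (scenarios m))
    ({state_at m \<alpha> i -` D \<inter> space (scenarios m) | i D. i \<le> t \<and> D \<in> sets (joint_states m)} \<union>
     {(\<lambda>\<omega>. \<alpha> \<omega> i) -` D \<inter> space (scenarios m) | i D. i < t \<and> D \<in> sets (joint_actions m)})"
    unfolding history_def by (intro sets_measure_of) auto
  also have "\<dots> \<subseteq> sets (scenarios m)"
    using assms measurable_state_at
    by (intro sets.sigma_sets_subset) (auto intro: measurable_sets)
  finally show ?thesis .
qed

text \<open>
  A control at time \<open>t\<close> is measurable in the history, which is generated by states and by controls
  before \<open>t\<close> only. Strong induction on \<open>t\<close> therefore shows that histories consist of events.
\<close>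

lemma measurable_control:
  assumes "\<alpha> \<in> policies m"
  shows "(\<lambda>\<omega>. \<alpha> \<omega> t) \<in> scenarios m \<rightarrow>\<^sub>M joint_actions m"
proof (induction t rule: less_induct)
  case (less t)
  have "subalgebra (scenarios m) (history m \<alpha> t)"
    using sets_history_subset[OF assms less] space_history by (simp add: subalgebra_def)
  moreover have "(\<lambda>\<omega>. \<alpha> \<omega> t) \<in> history m \<alpha> t \<rightarrow>\<^sub>M joint_actions m"
    using assms unfolding policies_def by blast
  ultimately show ?case
    by (rule measurable_from_subalg)
qed

lemma measurable_policy_pair:
  assumes "\<alpha> \<in> policies m"
  shows "(\<lambda>\<omega>. (state_at m \<alpha> t \<omega>, \<alpha> \<omega> t)) \<in> scenarios m \<rightarrow>\<^sub>M feasible_pairs m"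
  unfolding feasible_pairs_def
  using policy_pair_feasible[OF assms] measurable_state_at[OF assms] measurable_control[OF assms]
  by (intro measurable_restrict_space2 measurable_Pair) auto

lemma measurable_policy_kernel:
  assumes "\<alpha> \<in> policies m"
  shows "(\<lambda>\<omega>. joint_kernel m (state_at m \<alpha> t \<omega>) (\<alpha> \<omega> t)) \<in> scenarios m \<rightarrow>\<^sub>M prob_algebra (joint_states m)"
  using measurable_compose[OF measurable_policy_pair[OF assms] measurable_joint_kernel] by simp

section \<open>Expectations along a policy\<close>

text \<open>
  The conditional probabilities of the next state given the history are known almost surely. Taking
  their mean removes the conditioning, and the law of the next state is the mixture of the kernels.
\<close>

lemma next_state_law:
  assumes \<alpha>: "\<alpha> \<in> policies m" and x: "x \<in> space (joint_states m)"
  shows "distr (given_init m x) (joint_states m) (state_at m \<alpha> (Suc t)) =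
    given_init m x \<bind> (\<lambda>\<omega>. joint_kernel m (state_at m \<alpha> t \<omega>) (\<alpha> \<omega> t))"
    (is "?next = Giry_Monad.bind ?P ?K")
proof (rule measure_eqI)
  interpret prob_space ?P
    using x by (rule prob_space_given_init)
  note [measurable_cong] = sets_given_init[OF x]
  have X[measurable]: "state_at m \<alpha> (Suc t) \<in> ?P \<rightarrow>\<^sub>M joint_states m"
    using measurable_state_at[OF \<alpha>] by (simp cong: measurable_cong_sets add: sets_given_init[OF x])
  show "sets ?next = sets (?P \<bind> ?K)"
    using sets_bind'[OF given_init_prob_algebra[OF x] measurable_policy_kernel[OF \<alpha>]] by simp
  fix D assume "D \<in> sets ?next"
  then have D[measurable]: "D \<in> sets (joint_states m)" by simp
  have K_prob: "?K \<omega> \<in> space (prob_algebra (joint_states m))" if "\<omega> \<in> space ?P" for \<omega>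
    using measurable_space[OF measurable_policy_kernel[OF \<alpha>]] that by (simp add: space_given_init[OF x])
  have subalg: "subalgebra ?P (history m \<alpha> t)"
    using sets_history_subset[OF \<alpha> measurable_control[OF \<alpha>]]
    by (simp add: subalgebra_def space_history space_given_init[OF x] sets_given_init[OF x])
  interpret history: finite_measure_subalgebra ?P "history m \<alpha> t"
    using subalg by unfold_locales
  let ?in = "\<lambda>\<omega>. indicator D (state_at m \<alpha> (Suc t) \<omega>) :: real"
  have in_int: "integrable ?P ?in"
    by (intro integrable_const_bound[where B = 1]) (auto simp: indicator_def)
  have K_meas: "(\<lambda>\<omega>. measure (?K \<omega>) D) \<in> borel_measurable ?P"
    using measurable_compose[OF measurable_policy_kernel[OF \<alpha>] measurable_measure_prob_algebra[OF D]]
    by (simp cong: measurable_cong_sets add: sets_given_init[OF x])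
  have K_int: "integrable ?P (\<lambda>\<omega>. measure (?K \<omega>) D)"
    using K_meas K_prob
    by (intro integrable_const_bound[where B = 1])
      (auto simp: space_prob_algebra intro!: prob_space.prob_le_1)
  have "AE \<omega> in ?P. real_cond_exp ?P (history m \<alpha> t) ?in \<omega> = measure (?K \<omega>) D"
    using transition_law x \<alpha> D by blast
  then have "(\<integral>\<omega>. measure (?K \<omega>) D \<partial>?P) = (\<integral>\<omega>. real_cond_exp ?P (history m \<alpha> t) ?in \<omega> \<partial>?P)"
    using K_meas borel_measurable_cond_exp2 by (intro integral_cong_AE) auto
  also have "\<dots> = (\<integral>\<omega>. ?in \<omega> \<partial>?P)"
    by (rule history.real_cond_exp_int(2)[OF in_int])
  also have "\<dots> = measure ?next D"
    by (subst integral_distr[OF X, symmetric]) auto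
  finally have mean: "(\<integral>\<omega>. measure (?K \<omega>) D \<partial>?P) = measure ?next D" .
  have "emeasure (?P \<bind> ?K) D = (\<integral>\<^sup>+\<omega>. emeasure (?K \<omega>) D \<partial>?P)"
    by (rule emeasure_bind_prob_algebra[OF given_init_prob_algebra[OF x] measurable_policy_kernel[OF \<alpha>] D])
  also have "\<dots> = (\<integral>\<^sup>+\<omega>. ennreal (measure (?K \<omega>) D) \<partial>?P)"
  proof (rule nn_integral_cong)
    fix \<omega> assume "\<omega> \<in> space ?P"
    then interpret kernel: prob_space "?K \<omega>"
      using K_prob by (simp add: space_prob_algebra)
    show "emeasure (?K \<omega>) D = ennreal (measure (?K \<omega>) D)"
      by (rule kernel.emeasure_eq_measure)
  qed
  also have "\<dots> = ennreal (\<integral>\<omega>. measure (?K \<omega>) D \<partial>?P)"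
    using K_int by (intro nn_integral_eq_integral) auto
  also have "\<dots> = emeasure ?next D"
    using finite_measure.emeasure_eq_measure[OF finite_measure_distr[OF X]] by (simp add: mean)
  finally show "emeasure ?next D = emeasure (?P \<bind> ?K) D" ..
qed

text \<open>
  The tower property, obtained by integrating \<open>H\<close> against both descriptions of the law of the next
  state. It makes the term \<open>E[H(x') | x, a]\<close> cancel against \<open>H\<close> one time step later.
\<close>

lemma expectation_next_state:
  assumes \<alpha>: "\<alpha> \<in> policies m" and x: "x \<in> space (joint_states m)"
    and H: "H \<in> bounded_measurable m"
  shows "(\<integral>\<omega>. expected_next m H (state_at m \<alpha> t \<omega>) (\<alpha> \<omega> t) \<partial>given_init m x) =
    (\<integral>\<omega>. H (state_at m \<alpha> (Suc t) \<omega>) \<partial>given_init m x)"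
proof -
  interpret prob_space "given_init m x"
    using x by (rule prob_space_given_init)
  have X: "state_at m \<alpha> (Suc t) \<in> given_init m x \<rightarrow>\<^sub>M joint_states m"
    using measurable_state_at[OF \<alpha>] by (simp cong: measurable_cong_sets add: sets_given_init[OF x])
  have K: "(\<lambda>\<omega>. joint_kernel m (state_at m \<alpha> t \<omega>) (\<alpha> \<omega> t)) \<in> given_init m x \<rightarrow>\<^sub>M prob_algebra (joint_states m)"
    using measurable_policy_kernel[OF \<alpha>] by (simp cong: measurable_cong_sets add: sets_given_init[OF x])
  obtain C where C: "\<And>y. y \<in> space (joint_states m) \<Longrightarrow> \<bar>H y\<bar> \<le> C"
    and H_meas: "H \<in> borel_measurable (joint_states m)"
    using H by (auto simp: bounded_measurable_def)
  have "(\<integral>\<omega>. H (state_at m \<alpha> (Suc t) \<omega>) \<partial>given_init m x) =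
      (\<integral>y. H y \<partial>distr (given_init m x) (joint_states m) (state_at m \<alpha> (Suc t)))"
    using X H_meas by (rule integral_distr[symmetric])
  also have "\<dots> = (\<integral>\<omega>. expected_next m H (state_at m \<alpha> t \<omega>) (\<alpha> \<omega> t) \<partial>given_init m x)"
    unfolding next_state_law[OF \<alpha> x] expected_next_def
  proof (rule integral_bind[OF H_meas C measurable_prob_algebraD[OF K] finite_measure_axioms])
    show "AE \<omega> in given_init m x. emeasure (joint_kernel m (state_at m \<alpha> t \<omega>) (\<alpha> \<omega> t))
        (space (joint_kernel m (state_at m \<alpha> t \<omega>) (\<alpha> \<omega> t))) \<le> ennreal 1"
      using measurable_space[OF K] by (auto simp: space_prob_algebra prob_space.emeasure_space_1)
  qed
  finally show ?thesis ..
qed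

lemma penalized_reward_bounded:
  assumes "H \<in> bounded_measurable m"
  shows "\<exists>C. \<forall>\<omega>\<in>space (scenarios m). \<forall>T. \<forall>as\<in>feasible_upto m \<omega> T.
    \<bar>penalized_reward m H as \<omega> T\<bar> \<le> C * (real T + 1)"
proof -
  obtain C where C: "\<And>x a. x \<in> space (joint_states m) \<Longrightarrow> a \<in> feasible m x \<Longrightarrow> \<bar>bellman_gap m H x a\<bar> \<le> C"
    using bellman_gap_bounded[OF assms] by blast
  show ?thesis
  proof (intro exI ballI allI)
    fix \<omega> T as assume \<omega>: "\<omega> \<in> space (scenarios m)" and as: "as \<in> feasible_upto m \<omega> T"
    have "\<bar>penalized_reward m H as \<omega> T\<bar> \<le>
        (\<Sum>t\<le>T. \<bar>bellman_gap m H (traj m (take t as) \<omega>) (as ! t)\<bar>)"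
      unfolding penalized_reward_eq_gaps by (rule sum_abs)
    also have "\<dots> \<le> (\<Sum>t\<le>T. C)"
      using as feasible_along_step[OF \<omega>] by (intro sum_mono C) (auto simp: feasible_upto_def)
    finally show "\<bar>penalized_reward m H as \<omega> T\<bar> \<le> C * (real T + 1)"
      by (simp add: mult.commute add.commute)
  qed
qed

text \<open>
  With the tower property, the terms in \<open>H\<close> of the discounted mean gaps telescope. As \<open>H\<close> is bounded,
  the discounted remainder vanishes, and only the rewards and \<open>- H\<close> at the initial state are left.
\<close>

lemma value_eq_discounted_gaps:
  assumes \<alpha>: "\<alpha> \<in> policies m" and x: "x \<in> space (joint_states m)"
    and H: "H \<in> bounded_measurable m"
  shows "policy_value m \<alpha> x - H x =
    (\<Sum>t. discount m ^ t * (\<integral>\<omega>. bellman_gap m H (state_at m \<alpha> t \<omega>) (\<alpha> \<omega> t) \<partial>given_init m x))"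
proof -
  interpret prob_space "given_init m x"
    using x by (rule prob_space_given_init)
  let ?P = "given_init m x" and ?\<beta> = "discount m"
  let ?r = "\<lambda>t \<omega>. joint_reward m (state_at m \<alpha> t \<omega>) (\<alpha> \<omega> t)"
  let ?h = "\<lambda>t \<omega>. H (state_at m \<alpha> t \<omega>)"
  let ?g = "\<lambda>t \<omega>. expected_next m H (state_at m \<alpha> t \<omega>) (\<alpha> \<omega> t)"
  note in_P = space_given_init[OF x] sets_given_init[OF x]
  obtain C where C: "\<And>y. y \<in> space (joint_states m) \<Longrightarrow> \<bar>H y\<bar> \<le> C"
    and H_meas: "H \<in> borel_measurable (joint_states m)"
    using H by (auto simp: bounded_measurable_def)
  obtain D where D: "\<And>x a. x \<in> space (joint_states m) \<Longrightarrow> a \<in> feasible m x \<Longrightarrow> \<bar>joint_reward m x a\<bar> \<le> D"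
    using joint_reward_bounded by blast
  note pair = policy_pair_feasible[OF \<alpha>]
  have r_bound: "\<bar>?r t \<omega>\<bar> \<le> D" if "\<omega> \<in> space ?P" for t \<omega>
    using that by (intro D pair) (auto simp: in_P)
  have h_bound: "\<bar>?h t \<omega>\<bar> \<le> C" if "\<omega> \<in> space ?P" for t \<omega>
    using that by (intro C pair) (auto simp: in_P)
  have g_bound: "\<bar>?g t \<omega>\<bar> \<le> C" if "\<omega> \<in> space ?P" for t \<omega>
    using that by (intro expected_next_bounded C pair) (auto simp: in_P)
  have r_meas: "?r t \<in> borel_measurable ?P" for t
    using measurable_compose[OF measurable_policy_pair[OF \<alpha>, of t] measurable_joint_reward]
    by (simp cong: measurable_cong_sets add: in_P)
  have h_meas: "?h t \<in> borel_measurable ?P" for t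
    using measurable_compose[OF measurable_state_at[OF \<alpha>, of t] H_meas]
    by (simp cong: measurable_cong_sets add: in_P)
  have g_meas: "?g t \<in> borel_measurable ?P" for t
    using measurable_compose[OF measurable_policy_pair[OF \<alpha>, of t] measurable_expected_next[OF H_meas]]
    by (simp cong: measurable_cong_sets add: in_P)
  have r_int: "integrable ?P (?r t)" for t
    using r_meas r_bound by (intro integrable_const_bound[where B = D]) auto
  have h_int: "integrable ?P (?h t)" for t
    using h_meas h_bound by (intro integrable_const_bound[where B = C]) auto
  have g_int: "integrable ?P (?g t)" for t
    using g_meas g_bound by (intro integrable_const_bound[where B = C]) auto
  have summable_bounded: "summable (\<lambda>t. ?\<beta> ^ t * B)" for B
    using discount_bounds by (intro summable_mult2 summable_geometric) auto
  \<comment> \<open>Rewards are bounded, so the expectation of the discounted series may be taken term by term.\<close>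
  have "(\<lambda>t. \<integral>\<omega>. ?\<beta> ^ t * ?r t \<omega> \<partial>?P) sums policy_value m \<alpha> x"
    unfolding policy_value_def
  proof (rule sums_integral)
    show "integrable ?P (\<lambda>\<omega>. ?\<beta> ^ t * ?r t \<omega>)" for t
      using r_int by simp
    show "AE \<omega> in ?P. summable (\<lambda>t. norm (?\<beta> ^ t * ?r t \<omega>))"
    proof (rule AE_I2)
      fix \<omega> assume "\<omega> \<in> space ?P"
      then show "summable (\<lambda>t. norm (?\<beta> ^ t * ?r t \<omega>))"
        using discount_bounds r_bound
        by (intro summable_comparison_test'[OF summable_bounded[of D]])
          (auto simp: abs_mult intro!: mult_left_mono)
    qed
    have "(\<integral>\<omega>. norm (?\<beta> ^ t * ?r t \<omega>) \<partial>?P) \<le> ?\<beta> ^ t * D" for t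
    proof -
      have "\<bar>\<integral>\<omega>. norm (?\<beta> ^ t * ?r t \<omega>) \<partial>?P\<bar> \<le> ?\<beta> ^ t * D"
        using discount_bounds r_bound
        by (intro abs_expectation_le) (auto simp: abs_mult intro!: mult_left_mono)
      then show ?thesis by linarith
    qed
    then show "summable (\<lambda>t. \<integral>\<omega>. norm (?\<beta> ^ t * ?r t \<omega>) \<partial>?P)"
      by (intro summable_comparison_test'[OF summable_bounded[of D]]) auto
  qed
  then have reward_sums: "(\<lambda>t. ?\<beta> ^ t * (\<integral>\<omega>. ?r t \<omega> \<partial>?P)) sums policy_value m \<alpha> x"
    by simp
  have "(\<lambda>t. ?\<beta> ^ t * (\<integral>\<omega>. ?h t \<omega> \<partial>?P)) \<longlonglongrightarrow> 0"
  proof (rule Lim_null_comparison)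
    show "\<forall>\<^sub>F t in sequentially. norm (?\<beta> ^ t * (\<integral>\<omega>. ?h t \<omega> \<partial>?P)) \<le> ?\<beta> ^ t * C"
      using discount_bounds abs_expectation_le[of "?h _" C] h_bound
      by (intro always_eventually allI) (auto simp: abs_mult intro!: mult_left_mono)
    show "(\<lambda>t. ?\<beta> ^ t * C) \<longlonglongrightarrow> 0"
      by (rule summable_LIMSEQ_zero[OF summable_bounded])
  qed
  from telescope_sums[OF this]
  have penalty_sums: "(\<lambda>t. ?\<beta> ^ Suc t * (\<integral>\<omega>. ?h (Suc t) \<omega> \<partial>?P) - ?\<beta> ^ t * (\<integral>\<omega>. ?h t \<omega> \<partial>?P))
      sums (0 - (\<integral>\<omega>. ?h 0 \<omega> \<partial>?P))"
    by simp
  have "(\<integral>\<omega>. ?h 0 \<omega> \<partial>?P) = (\<integral>\<omega>. H x \<partial>?P)"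
  proof (rule integral_cong_AE[OF h_meas])
    have "AE \<omega> in ?P. traj m [] \<omega> = x"
      using initial_state x by blast
    then show "AE \<omega> in ?P. ?h 0 \<omega> = H x"
      by (auto simp: state_at_def)
  qed simp
  then have start: "(\<integral>\<omega>. ?h 0 \<omega> \<partial>?P) = H x"
    by (simp add: prob_space)
  have gap: "?\<beta> ^ t * (\<integral>\<omega>. bellman_gap m H (state_at m \<alpha> t \<omega>) (\<alpha> \<omega> t) \<partial>?P) =
      ?\<beta> ^ t * (\<integral>\<omega>. ?r t \<omega> \<partial>?P) +
      (?\<beta> ^ Suc t * (\<integral>\<omega>. ?h (Suc t) \<omega> \<partial>?P) - ?\<beta> ^ t * (\<integral>\<omega>. ?h t \<omega> \<partial>?P))" for t
    unfolding bellman_gap_def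
    using r_int h_int g_int expectation_next_state[OF \<alpha> x H, of t]
    by (simp add: algebra_simps)
  show ?thesis
    unfolding gap using sums_unique[OF sums_add[OF reward_sums penalty_sums]] by (simp add: start)
qed

section \<open>Duality\<close>

text \<open>
  Compare, scenario by scenario and for each horizon, the penalized reward of the controls of the
  policy with the maximum. Fubini and the geometric law turn the mean of the former into
  the value of the policy minus \<open>H\<close>.
\<close>

lemma weak_duality:
  assumes \<alpha>: "\<alpha> \<in> policies m" and x: "x \<in> space (joint_states m)"
    and H: "H \<in> bounded_measurable m" and max: "maxima_exist_measurable m H"
  shows "policy_value m \<alpha> x \<le> dual_bound m H x"
proof -
  let ?P = "given_init m x" and ?\<tau> = "measure_pmf (geometric_pmf (1 - discount m))"
  let ?gap = "\<lambda>t \<omega>. bellman_gap m H (state_at m \<alpha> t \<omega>) (\<alpha> \<omega> t)"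
  let ?sum = "\<lambda>(\<omega>, T). \<Sum>t\<le>T. ?gap t \<omega>"
  let ?max = "\<lambda>(\<omega>, T). max_penalized_reward m H \<omega> T"
  interpret prob_space ?P
    using x by (rule prob_space_given_init)
  interpret P\<tau>: pair_sigma_finite ?P ?\<tau> ..
  note in_P = space_given_init[OF x] sets_given_init[OF x]
  obtain C where C: "\<And>\<omega> T as. \<omega> \<in> space (scenarios m) \<Longrightarrow> as \<in> feasible_upto m \<omega> T \<Longrightarrow>
      \<bar>penalized_reward m H as \<omega> T\<bar> \<le> C * (real T + 1)"
    using penalized_reward_bounded[OF H] by blast
  obtain D where D: "\<And>x a. x \<in> space (joint_states m) \<Longrightarrow> a \<in> feasible m x \<Longrightarrow> \<bar>bellman_gap m H x a\<bar> \<le> D"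
    using bellman_gap_bounded[OF H] by blast
  have controls: "map (\<alpha> \<omega>) [0..<Suc T] \<in> feasible_upto m \<omega> T" if "\<omega> \<in> space ?P" for \<omega> T
    using policy_controls_feasible_along[OF \<alpha>, of \<omega> "Suc T"] that
    by (simp add: feasible_upto_def in_P)
  have sum_eq: "?sum (\<omega>, T) = penalized_reward m H (map (\<alpha> \<omega>) [0..<Suc T]) \<omega> T" for \<omega> T
    unfolding penalized_reward_eq_gaps case_prod_conv
    by (intro sum.cong refl) (simp add: state_at_def take_map nth_append del: upt_Suc)
  have gap_meas: "?gap t \<in> borel_measurable ?P" for t
  proof -
    have "H \<in> borel_measurable (joint_states m)"
      using H by (simp add: bounded_measurable_def)
    from measurable_compose[OF measurable_policy_pair[OF \<alpha>, of t] measurable_bellman_gap[OF this]]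
    show ?thesis
      by (simp cong: measurable_cong_sets add: in_P)
  qed
  have gap_bound: "\<bar>?gap t \<omega>\<bar> \<le> D" if "\<omega> \<in> space ?P" for t \<omega>
    using that by (intro D policy_pair_feasible[OF \<alpha>]) (auto simp: in_P)
  have gap_int: "integrable ?P (?gap t)" for t
    using gap_meas gap_bound by (intro integrable_const_bound[where B = D]) auto
  have sum_int: "integrable (?P \<Otimes>\<^sub>M ?\<tau>) ?sum"
  proof (rule integrable_geometric_time[OF discount_bounds])
    show "(\<lambda>\<omega>. ?sum (\<omega>, T)) \<in> borel_measurable ?P" for T
      using gap_meas by simp
    show "\<bar>?sum (\<omega>, T)\<bar> \<le> C * (real T + 1)" if "\<omega> \<in> space ?P" for \<omega> T
      unfolding sum_eq using that controls by (intro C) (auto simp: in_P)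
  qed
  have max_ex: "has_maximum (\<lambda>as. penalized_reward m H as \<omega> T) (feasible_upto m \<omega> T)"
    if "\<omega> \<in> space ?P" for \<omega> T
    using max that by (auto simp: maxima_exist_measurable_def in_P)
  have max_int: "integrable (?P \<Otimes>\<^sub>M ?\<tau>) ?max"
  proof (rule integrable_geometric_time[OF discount_bounds])
    show "(\<lambda>\<omega>. ?max (\<omega>, T)) \<in> borel_measurable ?P" for T
      using max by (simp add: maxima_exist_measurable_def in_P cong: measurable_cong_sets)
    show "\<bar>?max (\<omega>, T)\<bar> \<le> C * (real T + 1)" if \<omega>: "\<omega> \<in> space ?P" for \<omega> T
    proof -
      obtain as where "as \<in> feasible_upto m \<omega> T" "?max (\<omega>, T) = penalized_reward m H as \<omega> T"
        using maximum_in_image[OF max_ex[OF \<omega>]] by (auto simp: max_penalized_reward_def)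
      then show ?thesis
        using C \<omega> by (simp add: in_P)
    qed
  qed
  have "policy_value m \<alpha> x - H x = (\<Sum>t. discount m ^ t * (\<integral>\<omega>. ?gap t \<omega> \<partial>?P))"
    by (rule value_eq_discounted_gaps[OF \<alpha> x H])
  also have "\<dots> = (\<integral>T. (\<Sum>t\<le>T. \<integral>\<omega>. ?gap t \<omega> \<partial>?P) \<partial>?\<tau>)"
    using gap_bound
    by (intro geometric_partial_sums[OF discount_bounds, symmetric] abs_expectation_le)
  also have "\<dots> = (\<integral>T. (\<integral>\<omega>. (\<Sum>t\<le>T. ?gap t \<omega>) \<partial>?P) \<partial>?\<tau>)"
    using gap_int by simp
  also have "\<dots> = integral\<^sup>L (?P \<Otimes>\<^sub>M ?\<tau>) ?sum"
    by (rule P\<tau>.integral_snd[OF sum_int])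
  also have "\<dots> \<le> integral\<^sup>L (?P \<Otimes>\<^sub>M ?\<tau>) ?max"
  proof (rule integral_mono[OF sum_int max_int])
    fix z assume "z \<in> space (?P \<Otimes>\<^sub>M ?\<tau>)"
    then obtain \<omega> T where z: "z = (\<omega>, T)" and \<omega>: "\<omega> \<in> space ?P"
      by (auto simp: space_pair_measure)
    show "?sum z \<le> ?max z"
      unfolding z sum_eq unfolding case_prod_conv max_penalized_reward_def
      by (rule maximum_upper[OF max_ex[OF \<omega>] controls[OF \<omega>]])
  qed
  finally show ?thesis
    by (simp add: dual_bound_def)
qed

text \<open>
  Feasible sequences only visit feasible pairs, and there every gap of a supersolution is at most
  \<open>0\<close>; so the bound holds in each scenario and not only on average.
\<close>

lemma max_penalized_reward_nonpos:
  assumes H: "H \<in> supersolutions m" and max: "maxima_exist_measurable m H"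
    and \<omega>: "\<omega> \<in> space (scenarios m)"
  shows "max_penalized_reward m H \<omega> T \<le> 0"
proof -
  have "penalized_reward m H as \<omega> T \<le> 0" if "as \<in> feasible_upto m \<omega> T" for as
    unfolding penalized_reward_eq_gaps
  proof (rule sum_nonpos)
    fix t assume "t \<in> {..T}"
    then show "bellman_gap m H (traj m (take t as) \<omega>) (as ! t) \<le> 0"
      using that H feasible_along_step[OF \<omega>, of as t]
      by (simp add: feasible_upto_def supersolutions_def bellman_gap_def)
  qed
  moreover obtain as where "as \<in> feasible_upto m \<omega> T"
      "max_penalized_reward m H \<omega> T = penalized_reward m H as \<omega> T"
    using max \<omega> unfolding maxima_exist_measurable_def max_penalized_reward_def
    by (blast dest: maximum_in_image)
  ultimately show ?thesis by simp
qed

lemma dual_bound_le_supersolution: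
  assumes H: "H \<in> supersolutions m" and max: "maxima_exist_measurable m H"
    and x: "x \<in> space (joint_states m)"
  shows "dual_bound m H x \<le> H x"
proof -
  have "0 \<le> (\<integral>z. - (case z of (\<omega>, T) \<Rightarrow> max_penalized_reward m H \<omega> T)
      \<partial>(given_init m x \<Otimes>\<^sub>M measure_pmf (geometric_pmf (1 - discount m))))"
    using max_penalized_reward_nonpos[OF H max] space_given_init[OF x]
    by (intro Bochner_Integration.integral_nonneg) (auto simp: space_pair_measure)
  then show ?thesis
    by (simp add: dual_bound_def)
qed

lemma policy_value_bounded:
  "\<exists>C. \<forall>\<alpha>\<in>policies m. \<forall>x\<in>space (joint_states m). \<bar>policy_value m \<alpha> x\<bar> \<le> C"
proof -
  obtain D where D: "\<And>x a. x \<in> space (joint_states m) \<Longrightarrow> a \<in> feasible m x \<Longrightarrow> \<bar>joint_reward m x a\<bar> \<le> D"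
    using joint_reward_bounded by blast
  show ?thesis
  proof (intro exI ballI)
    fix \<alpha> x assume \<alpha>: "\<alpha> \<in> policies m" and x: "x \<in> space (joint_states m)"
    interpret prob_space "given_init m x"
      using x by (rule prob_space_given_init)
    show "\<bar>policy_value m \<alpha> x\<bar> \<le> (\<Sum>t. discount m ^ t * D)"
      unfolding policy_value_def
    proof (rule abs_expectation_le)
      fix \<omega> assume "\<omega> \<in> space (given_init m x)"
      then have "norm (discount m ^ t * joint_reward m (state_at m \<alpha> t \<omega>) (\<alpha> \<omega> t)) \<le> discount m ^ t * D" for t
        using discount_bounds policy_pair_feasible[OF \<alpha>, of \<omega> t] D
        by (simp add: abs_mult space_given_init[OF x])
      then have "norm (\<Sum>t. discount m ^ t * joint_reward m (state_at m \<alpha> t \<omega>) (\<alpha> \<omega> t))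
          \<le> (\<Sum>t. discount m ^ t * D)"
        using discount_bounds by (intro norm_suminf_le summable_mult2 summable_geometric) auto
      then show "\<bar>\<Sum>t. discount m ^ t * joint_reward m (state_at m \<alpha> t \<omega>) (\<alpha> \<omega> t)\<bar>
          \<le> (\<Sum>t. discount m ^ t * D)"
        by simp
    qed
  qed
qed

text \<open>
  The inequality is half of the Bellman equation. Boundedness comes from attainment: each optimal
  value is the value of some policy, and these are bounded uniformly by a geometric series.
\<close>

lemma opt_value_supersolution:
  assumes attained: "value_attained m" and bellman: "bellman_equation m"
  shows "opt_value m \<in> supersolutions m"
proof -
  obtain C where C: "\<And>\<alpha> x. \<alpha> \<in> policies m \<Longrightarrow> x \<in> space (joint_states m) \<Longrightarrow> \<bar>policy_value m \<alpha> x\<bar> \<le> C"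
    using policy_value_bounded by blast
  have "\<bar>opt_value m x\<bar> \<le> C" if "x \<in> space (joint_states m)" for x
    using attained that C unfolding value_attained_def by metis
  then have "opt_value m \<in> bounded_measurable m"
    using bellman by (auto simp: bounded_measurable_def bellman_equation_def)
  moreover have "joint_reward m x a + discount m * expected_next m (opt_value m) x a \<le> opt_value m x"
    if x: "x \<in> space (joint_states m)" and a: "a \<in> feasible m x" for x a
  proof -
    let ?f = "\<lambda>a. joint_reward m x a + discount m * expected_next m (opt_value m) x a"
    have "has_maximum ?f (feasible m x)" and eq: "opt_value m x = maximum ?f (feasible m x)"
      using bellman x by (auto simp: bellman_equation_def)
    from maximum_upper[OF this(1) a] show ?thesis
      by (simp only: eq)
  qed
  ultimately show ?thesis
    by (simp add: supersolutions_def)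
qed

end

theorem theorem1:
  fixes m :: "('n::finite, 's, 'a, 'l::finite, 'w) scenario_wcdp"
  assumes "is_scenario_wcdp m"
    and "value_attained m"
    and "bellman_equation m"
  shows
    "(\<forall>H\<in>bounded_measurable m. maxima_exist_measurable m H \<longrightarrow>
        (\<forall>x\<in>space (joint_states m). opt_value m x \<le> dual_bound m H x)) \<and>
     (\<forall>H\<in>supersolutions m. maxima_exist_measurable m H \<longrightarrow>
        (\<forall>\<omega>\<in>space (scenarios m). \<forall>T. max_penalized_reward m H \<omega> T \<le> 0) \<and>
        (\<forall>x\<in>space (joint_states m). dual_bound m H x \<le> H x)) \<and>
     (maxima_exist_measurable m (opt_value m) \<longrightarrow>
        (\<forall>x\<in>space (joint_states m). opt_value m x = dual_bound m (opt_value m) x))"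
proof -
  interpret scenario_program m
    using assms(1) by unfold_locales
  have weak: "opt_value m x \<le> dual_bound m H x"
    if "H \<in> bounded_measurable m" "maxima_exist_measurable m H" "x \<in> space (joint_states m)" for H x
    using assms(2) that weak_duality unfolding value_attained_def by metis
  have "opt_value m \<in> supersolutions m"
    using assms(2,3) by (rule opt_value_supersolution)
  \<comment> \<open>Weak duality is one inequality; the other is the bound for supersolutions, applied to the optimal value.\<close>
  then have "opt_value m x = dual_bound m (opt_value m) x"
    if "maxima_exist_measurable m (opt_value m)" "x \<in> space (joint_states m)" for x
    using that weak dual_bound_le_supersolution
    by (intro antisym) (auto simp: supersolutions_def)
  then show ?thesis
    using weak max_penalized_reward_nonpos dual_bound_le_supersolution by blast
qed

end
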